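(* Let $A$ be an idiom, let $s\in S(A)$ be a stable inflator on $A$ and let $J\in S(S(A))$ be a stable inflator on $S(A)$. The following are equivalent: (1) $J^{\infty}\mu^{s^{\infty}}=Tp$ (i.e. $\Xi(\mu^{s^{\infty}})(J^{\infty})=Tp$, where $\Xi(\mu^{s^\infty})(K)=K\mu^{s^\infty}$ for $K\in S(S(A))$). (2) $\mathfrak{t}(\mu^{s^{\infty}})\le J^{\infty}$. (3) $s^{\infty}$ has $J$-dimension, i.e. $J^{\infty}(s^{\infty})=\bar{d}$.
   Context: An idiom is a complete modular lattice $A$ with top $\bar{1}$ and bottom $\underline{0}$ that is meet-continuous: $a\wedge\bigvee X=\bigvee\{a\wedge x\mid x\in X\}$ for all $a\in A$ and all directed $X\subseteq A$. An inflator on a complete lattice $L$ is a monotone map $d\colon L\to L$ with $x\le d(x)$ for all $x$; it is stable if $d(x)\wedge y\le d(x\wedge y)$ for all $x,y\in L$. $S(L)$ is the set of stable inflators on $L$, ordered pointwise; it is a complete lattice with infima computed pointwise and with top the constant map to the top of $L$. Thus $S(A)$ has top $\bar{d}$ ($\bar{d}(a)=\bar{1}$ for all $a$) and bottom $d_{\underline{0}}=\mathrm{id}_A$, and $S(S(A))$ is the lattice of stable inflators on the complete lattice $S(A)$; its top is denoted $Tp$ (so $Tp(d)=\bar{d}$ for all $d\in S(A)$). Products of inflators are compositions. For an inflator $d$ on $L$, define $d^0=\mathrm{id}$, $d^{\alpha+1}=d\circ d^{\alpha}$, and $d^{\lambda}=\bigvee\{d^{\alpha}\mid\alpha<\lambda\}$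 (pointwise) for limit ordinals $\lambda$; $d^{\infty}$ is the eventual stable value of this increasing chain, which is idempotent; if $d$ is stable then $d^\infty$ is stable. For $k\in S(A)$, $\mu^{k}\in S(S(A))$ is given by $\mu^{k}(d)=d\circ k$. For $M\in S(S(A))$, its partial totalizer in $S(S(A))$ is $\mathfrak{t}(M)=\bigwedge\{K\in S(S(A))\mid KM=Tp\}$. *)

theory Defs
  imports Main
begin

section \<open>Idioms\<close>

definition (in order) directed :: "'a set \<Rightarrow> bool" where
  "directed X \<longleftrightarrow> X \<noteq> {} \<and> (\<forall>x\<in>X. \<forall>y\<in>X. \<exists>z\<in>X. x \<le> z \<and> y \<le> z)"

class meet_continuous_lattice = complete_lattice +
  assumes inf_Sup_directed: "directed X \<Longrightarrow> inf a (Sup X) = (SUP x\<in>X. inf a x)"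

class idiom = meet_continuous_lattice +
  assumes modular: "a \<le> c \<Longrightarrow> inf (sup a b) c = sup a (inf b c)"


section \<open>Stable inflators\<close>

definition inflator :: "('a::complete_lattice \<Rightarrow> 'a) \<Rightarrow> bool" where
  "inflator d \<longleftrightarrow> mono d \<and> (\<forall>x. x \<le> d x)"

definition stable_map :: "('a::complete_lattice \<Rightarrow> 'a) \<Rightarrow> bool" where
  "stable_map d \<longleftrightarrow> (\<forall>x y. inf (d x) y \<le> d (inf x y))"

typedef (overloaded) 'a stable_inflator =
  "{d :: 'a::complete_lattice \<Rightarrow> 'a. inflator d \<and> stable_map d}"
  morphisms app Abs_stable_inflator
  by (rule exI[of _ id]) (auto simp: inflator_def stable_map_def mono_def)

text \<open>
  The type \<open>'a stable_inflator\<close> is the set $S(A)$, for $A$ the type \<open>'a\<close>, and \<open>app d a\<close> is the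
  value $d(a)$. Since it is again a complete lattice, \<open>'a stable_inflator stable_inflator\<close>
  is $S(S(A))$.
\<close>

setup_lifting type_definition_stable_inflator

lemma stable_inflatorI:
  assumes "\<And>x y. x \<le> y \<Longrightarrow> d x \<le> d y" "\<And>x. x \<le> d x" "\<And>x y. inf (d x) y \<le> d (inf x y)"
  shows "inflator d \<and> stable_map d"
  using assms by (simp add: inflator_def stable_map_def mono_def)

lemma app_mono: "x \<le> y \<Longrightarrow> app d x \<le> app d y"
  using app[of d] by (auto simp: inflator_def mono_def)

lemma app_ge: "x \<le> app d x"
  using app[of d] by (auto simp: inflator_def)

lemma app_stable: "inf (app d x) y \<le> app d (inf x y)"
  using app[of d] by (auto simp: stable_map_def)

instantiation stable_inflator :: (complete_lattice) order
begin

lift_definition less_eq_stable_inflator :: "'a stable_inflator \<Rightarrow> 'a stable_inflator \<Rightarrow> bool"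
  is "\<lambda>d e. \<forall>x. d x \<le> e x" .

definition less_stable_inflator :: "'a stable_inflator \<Rightarrow> 'a stable_inflator \<Rightarrow> bool"
  where "d < e \<longleftrightarrow> d \<le> e \<and> \<not> e \<le> (d :: 'a stable_inflator)"

lemma le_iff_app: "d \<le> e \<longleftrightarrow> (\<forall>x. app d x \<le> app e x)"
  by (rule less_eq_stable_inflator.rep_eq)

instance
proof
  fix d e f :: "'a stable_inflator"
  show "d < e \<longleftrightarrow> d \<le> e \<and> \<not> e \<le> d" by (rule less_stable_inflator_def)
  show "d \<le> d" by (simp add: le_iff_app)
  show "d \<le> f" if "d \<le> e" "e \<le> f"
    using that unfolding le_iff_app by (meson order_trans)
  show "d = e" if "d \<le> e" "e \<le> d"
    using that by (simp add: le_iff_app fun_eq_iff order.eq_iff flip: app_inject)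
qed

end

instantiation stable_inflator :: (complete_lattice) complete_lattice
begin

lift_definition top_stable_inflator :: "'a stable_inflator" is "\<lambda>x. top"
  by (rule stable_inflatorI) auto

lift_definition bot_stable_inflator :: "'a stable_inflator" is "\<lambda>x. x"
  by (rule stable_inflatorI) auto

lift_definition inf_stable_inflator :: "'a stable_inflator \<Rightarrow> 'a stable_inflator \<Rightarrow> 'a stable_inflator"
  is "\<lambda>d e x. inf (d x) (e x)"
  subgoal for d e
    by (rule stable_inflatorI)
      (auto simp: inflator_def stable_map_def mono_def intro: le_infI1 le_infI2
        order_trans[OF inf_mono[OF inf_le1 order_refl]] order_trans[OF inf_mono[OF inf_le2 order_refl]])
  done

lift_definition Inf_stable_inflator :: "'a stable_inflator set \<Rightarrow> 'a stable_inflator"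
  is "\<lambda>D x. INF d\<in>D. d x"
  subgoal premises prems for D
  proof (rule stable_inflatorI)
    show "(INF d\<in>D. d x) \<le> (INF d\<in>D. d y)" if "x \<le> y" for x y
      using prems that by (intro INF_mono bexI) (auto simp: inflator_def mono_def)
    show "x \<le> (INF d\<in>D. d x)" for x
      using prems by (auto simp: inflator_def intro!: INF_greatest)
    show "inf (INF d\<in>D. d x) y \<le> (INF d\<in>D. d (inf x y))" for x y
    proof (rule INF_greatest)
      fix d assume "d \<in> D"
      then have "inf (INF d\<in>D. d x) y \<le> inf (d x) y"
        by (meson INF_lower inf_mono order_refl)
      also have "\<dots> \<le> d (inf x y)"
        using prems \<open>d \<in> D\<close> by (auto simp: stable_map_def)
      finally show "inf (INF d\<in>D. d x) y \<le> d (inf x y)" .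
    qed
  qed
  done

definition Sup_stable_inflator :: "'a stable_inflator set \<Rightarrow> 'a stable_inflator"
  where "Sup D = Inf {u. \<forall>d\<in>D. d \<le> (u :: 'a stable_inflator)}"

definition sup_stable_inflator :: "'a stable_inflator \<Rightarrow> 'a stable_inflator \<Rightarrow> 'a stable_inflator"
  where "sup d e = Inf {u. d \<le> u \<and> e \<le> (u :: 'a stable_inflator)}"

instance
proof
  fix d e u :: "'a stable_inflator" and D :: "'a stable_inflator set"
  have lower: "Inf D \<le> d" if "d \<in> D" for d and D :: "'a stable_inflator set"
    unfolding le_iff_app Inf_stable_inflator.rep_eq using that by (blast intro: INF_lower)
  have greatest: "d \<le> Inf D" if "\<And>e. e \<in> D \<Longrightarrow> d \<le> e" for d and D :: "'a stable_inflator set"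
    unfolding le_iff_app Inf_stable_inflator.rep_eq
    using that by (intro allI INF_greatest) (auto simp: le_iff_app)
  have bot: "bot \<le> d" for d :: "'a stable_inflator"
    by (simp add: le_iff_app bot_stable_inflator.rep_eq app_ge)
  show "inf d e \<le> d" "inf d e \<le> e"
    by (simp_all add: le_iff_app inf_stable_inflator.rep_eq)
  show "u \<le> inf d e" if "u \<le> d" "u \<le> e"
    using that by (simp add: le_iff_app inf_stable_inflator.rep_eq)
  show "d \<le> sup d e" "e \<le> sup d e"
    unfolding sup_stable_inflator_def by (rule greatest; simp)+
  show "sup d e \<le> u" if "d \<le> u" "e \<le> u"
    unfolding sup_stable_inflator_def using that by (intro lower) simp
  show "Inf D \<le> d" if "d \<in> D" using that by (rule lower)
  show "u \<le> Inf D" if "\<And>d. d \<in> D \<Longrightarrow> u \<le> d" using that by (rule greatest)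
  show "d \<le> Sup D" if "d \<in> D"
    unfolding Sup_stable_inflator_def using that by (intro greatest) simp
  show "Sup D \<le> u" if "\<And>d. d \<in> D \<Longrightarrow> d \<le> u"
    unfolding Sup_stable_inflator_def using that by (intro lower) simp
  show "Inf {} = (top :: 'a stable_inflator)"
    by transfer simp
  show "Sup {} = (bot :: 'a stable_inflator)"
    unfolding Sup_stable_inflator_def by (intro antisym lower bot) simp
qed

end

lemma SUP_directed_stable_inflator:
  fixes F :: "('a::meet_continuous_lattice \<Rightarrow> 'a) set"
  assumes "directed F" and F: "\<And>f. f \<in> F \<Longrightarrow> inflator f \<and> stable_map f"
  shows "inflator (\<lambda>x. SUP f\<in>F. f x) \<and> stable_map (\<lambda>x. SUP f\<in>F. f x)"
proof (rule stable_inflatorI)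
  have "\<exists>h\<in>F. f x \<le> h x \<and> g x \<le> h x" if "f \<in> F" "g \<in> F" for f g x
    using assms(1) that unfolding directed_def by (meson le_funD)
  then have dir: "directed ((\<lambda>f. f x) ` F)" for x
    using assms(1) by (simp add: directed_def)
  have mono: "f x \<le> f y" if "f \<in> F" "x \<le> y" for f x y
    using F[OF that(1)] that(2) by (simp add: inflator_def mono_def)
  have st: "inf y (f x) \<le> f (inf x y)" if "f \<in> F" for f x y
    using F[OF that] by (simp add: stable_map_def inf.commute[of y])
  show "(SUP f\<in>F. f x) \<le> (SUP f\<in>F. f y)" if "x \<le> y" for x y
    using mono that by (intro SUP_least) (rule SUP_upper2)
  obtain f where f: "f \<in> F" using assms(1) by (auto simp: directed_def)
  show "x \<le> (SUP f\<in>F. f x)" for x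
    using f by (rule SUP_upper2) (use F[OF f] in \<open>simp add: inflator_def\<close>)
  show "inf (SUP f\<in>F. f x) y \<le> (SUP f\<in>F. f (inf x y))" for x y
  proof -
    have "inf (SUP f\<in>F. f x) y = inf y (SUP f\<in>F. f x)" by (rule inf.commute)
    also have "\<dots> = (SUP f\<in>F. inf y (f x))"
      using inf_Sup_directed[OF dir, of y x] by (simp only: image_image)
    also have "\<dots> \<le> (SUP f\<in>F. f (inf x y))"
      using st by (intro SUP_least) (rule SUP_upper2)
    finally show ?thesis .
  qed
qed

lemma app_Sup_directed:
  fixes D :: "'a::meet_continuous_lattice stable_inflator set"
  assumes "directed D"
  shows "app (Sup D) x = (SUP d\<in>D. app d x)"
proof -
  have "directed (app ` D)"
    using assms unfolding directed_def le_iff_app le_fun_def by blast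
  from SUP_directed_stable_inflator[OF this]
  have st: "inflator (\<lambda>x. SUP d\<in>D. app d x) \<and> stable_map (\<lambda>x. SUP d\<in>D. app d x)"
    using app by (auto simp: image_image)
  define e where "e = Abs_stable_inflator (\<lambda>x. SUP d\<in>D. app d x)"
  have e: "app e x = (SUP d\<in>D. app d x)" for x
    unfolding e_def using st by (simp add: Abs_stable_inflator_inverse)
  have "Sup D = e"
  proof (rule antisym)
    show "Sup D \<le> e"
      by (rule Sup_least) (auto simp: le_iff_app e intro: SUP_upper)
    have "app d x \<le> app (Sup D) x" if "d \<in> D" for d x
      using Sup_upper[OF that] by (simp add: le_iff_app)
    then show "e \<le> Sup D"
      unfolding le_iff_app e by (intro allI SUP_least)
  qed
  then show ?thesis by (simp add: e)
qed

instance stable_inflator :: (meet_continuous_lattice) meet_continuous_lattice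
proof
  fix a :: "'a stable_inflator" and X :: "'a stable_inflator set"
  assume dX: "directed X"
  have ub: "\<exists>f\<in>X. d \<le> f \<and> e \<le> f" if "d \<in> X" "e \<in> X" for d e
    using dX that by (simp add: directed_def)
  have "\<exists>f\<in>X. inf a d \<le> inf a f \<and> inf a e \<le> inf a f" if "d \<in> X" "e \<in> X" for d e
    using ub[OF that] by (meson inf_mono order_refl)
  then have daX: "directed (inf a ` X)"
    using dX by (simp add: directed_def)
  have "\<exists>f\<in>X. app d x \<le> app f x \<and> app e x \<le> app f x" if "d \<in> X" "e \<in> X" for d e x
    using ub[OF that] by (meson le_iff_app)
  then have dir: "directed ((\<lambda>d. app d x) ` X)" for x
    using dX by (simp add: directed_def)
  have "app (inf a (Sup X)) x = app (Sup (inf a ` X)) x" for x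
  proof -
    have "app (inf a (Sup X)) x = inf (app a x) (SUP d\<in>X. app d x)"
      by (simp add: app_Sup_directed[OF dX] inf_stable_inflator.rep_eq)
    also have "\<dots> = (SUP d\<in>X. inf (app a x) (app d x))"
      using inf_Sup_directed[OF dir] by (simp only: image_image)
    also have "\<dots> = app (Sup (inf a ` X)) x"
      by (simp add: app_Sup_directed[OF daX] inf_stable_inflator.rep_eq image_image)
    finally show ?thesis .
  qed
  then show "inf a (Sup X) = (SUP x\<in>X. inf a x)"
    by (simp add: fun_eq_iff flip: app_inject)
qed

lemma stable_inflator_comp:
  assumes "inflator d \<and> stable_map d" "inflator e \<and> stable_map e"
  shows "inflator (\<lambda>x. d (e x)) \<and> stable_map (\<lambda>x. d (e x))"
proof (rule stable_inflatorI)
  show "d (e x) \<le> d (e y)" if "x \<le> y" for x y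
    using assms that by (auto simp: inflator_def mono_def)
  show "x \<le> d (e x)" for x
    using assms by (meson inflator_def order_trans)
  show "inf (d (e x)) y \<le> d (e (inf x y))" for x y
    using assms by (meson inflator_def stable_map_def mono_def order_trans)
qed

lift_definition inflator_comp ::
  "'a::complete_lattice stable_inflator \<Rightarrow> 'a stable_inflator \<Rightarrow> 'a stable_inflator"  (infixr "\<cdot>" 75)
  is "\<lambda>d e x. d (e x)"
  by (rule stable_inflator_comp)


section \<open>Transfinite iteration\<close>

text \<open>
  Ordinals are represented by the elements of a well-ordered type. The iterates of a map on
  \<open>'a\<close> become stationary before \<open>card_of (UNIV :: ('a \<Rightarrow> 'a) set set)\<close>, since
  otherwise they would be that many different elements of \<open>'a \<Rightarrow> 'a\<close>; so the type
  \<open>('a \<Rightarrow> 'a) ordinal\<close>, which is well-ordered in that order type, has all the ordinals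
  needed.
\<close>

typedef 'b ordinal = "UNIV :: 'b set set" by simp

instantiation ordinal :: (type) wellorder
begin

definition less_eq_ordinal :: "'a ordinal \<Rightarrow> 'a ordinal \<Rightarrow> bool" where
  "\<alpha> \<le> \<beta> \<longleftrightarrow> (Rep_ordinal \<alpha>, Rep_ordinal \<beta>) \<in> card_of (UNIV :: 'a set set)"

definition less_ordinal :: "'a ordinal \<Rightarrow> 'a ordinal \<Rightarrow> bool" where
  "\<alpha> < \<beta> \<longleftrightarrow> \<alpha> \<le> \<beta> \<and> \<not> \<beta> \<le> (\<alpha> :: 'a ordinal)"

instance
proof -
  let ?r = "card_of (UNIV :: 'a set set)"
  have wo: "well_order_on UNIV ?r" by (rule card_of_well_order_on)
  then have lin: "refl ?r" "trans ?r" "antisym ?r" "total ?r" and wf: "wf (?r - Id)"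
    by (auto simp: well_order_on_def linear_order_on_def partial_order_on_def preorder_on_def)
  have less: "\<alpha> < \<beta> \<longleftrightarrow> (Rep_ordinal \<alpha>, Rep_ordinal \<beta>) \<in> ?r - Id" for \<alpha> \<beta> :: "'a ordinal"
    unfolding less_ordinal_def less_eq_ordinal_def using lin
    by (auto simp: antisym_def refl_on_def)
  have wfo: "wf {(\<alpha>, \<beta>). \<alpha> < (\<beta> :: 'a ordinal)}"
    using wf_inv_image[OF wf, of Rep_ordinal] by (simp add: less inv_image_def)
  show "OFCLASS('a ordinal, wellorder_class)"
  proof (intro_classes)
    fix \<alpha> \<beta> \<gamma> :: "'a ordinal"
    show "\<alpha> < \<beta> \<longleftrightarrow> \<alpha> \<le> \<beta> \<and> \<not> \<beta> \<le> \<alpha>" by (rule less_ordinal_def)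
    show "\<alpha> \<le> \<alpha>" using lin(1) by (simp add: less_eq_ordinal_def refl_on_def)
    show "\<alpha> \<le> \<gamma>" if "\<alpha> \<le> \<beta>" "\<beta> \<le> \<gamma>"
      using that lin(2) unfolding less_eq_ordinal_def by (rule transD[rotated])
    show "\<alpha> = \<beta>" if "\<alpha> \<le> \<beta>" "\<beta> \<le> \<alpha>"
      using that lin(3) unfolding less_eq_ordinal_def antisym_def by (metis Rep_ordinal_inject)
    show "\<alpha> \<le> \<beta> \<or> \<beta> \<le> \<alpha>"
      using lin(1,4) unfolding less_eq_ordinal_def total_on_def refl_on_def by (metis UNIV_I)
    show "P \<alpha>" if "\<And>\<alpha>. (\<And>\<beta>. \<beta> < \<alpha> \<Longrightarrow> P \<beta>) \<Longrightarrow> P \<alpha>" for P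
      using wfo by (rule wf_induct_rule) (use that in auto)
  qed
qed

end

definition is_zero :: "'o::wellorder \<Rightarrow> bool" where
  "is_zero \<alpha> \<longleftrightarrow> (\<forall>\<beta>. \<alpha> \<le> \<beta>)"

definition is_succ_of :: "'o::wellorder \<Rightarrow> 'o \<Rightarrow> bool" where
  "is_succ_of \<alpha> \<beta> \<longleftrightarrow> \<beta> < \<alpha> \<and> (\<forall>\<gamma>. \<gamma> < \<alpha> \<longrightarrow> \<gamma> \<le> \<beta>)"

lemma is_succ_of_unique: "is_succ_of \<alpha> \<beta> \<Longrightarrow> is_succ_of \<alpha> \<gamma> \<Longrightarrow> \<beta> = \<gamma>"
  by (auto simp: is_succ_of_def intro: antisym)

lemma is_succ_of_the: "is_succ_of \<alpha> \<beta> \<Longrightarrow> (THE \<beta>. is_succ_of \<alpha> \<beta>) = \<beta>"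
  by (blast intro: the_equality is_succ_of_unique)

definition is_limit :: "'o::wellorder \<Rightarrow> bool" where
  "is_limit \<alpha> \<longleftrightarrow> \<not> is_zero \<alpha> \<and> (\<nexists>\<beta>. is_succ_of \<alpha> \<beta>)"

function iter :: "('a::complete_lattice \<Rightarrow> 'a) \<Rightarrow> 'o::wellorder \<Rightarrow> 'a \<Rightarrow> 'a" where
  "iter d \<alpha> =
    (if is_zero \<alpha> then id
     else if \<exists>\<beta>. is_succ_of \<alpha> \<beta> then d \<circ> iter d (THE \<beta>. is_succ_of \<alpha> \<beta>)
     else (\<lambda>x. SUP \<beta>\<in>{..<\<alpha>}. iter d \<beta> x))"
  by auto
termination
proof (relation "inv_image {(\<alpha>, \<beta>). \<alpha> < \<beta>} snd")
  show "wf (inv_image {(\<alpha>, \<beta>). \<alpha> < \<beta>} (snd :: ('a \<Rightarrow> 'a) \<times> 'o::wellorder \<Rightarrow> 'o))"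
    by (rule wf_inv_image[OF wf])
next
  fix d :: "'a \<Rightarrow> 'a" and \<alpha> :: "'o::wellorder"
  assume "\<exists>\<beta>. is_succ_of \<alpha> \<beta>"
  then obtain \<beta> where "is_succ_of \<alpha> \<beta>" by blast
  then show "((d, THE \<beta>. is_succ_of \<alpha> \<beta>), (d, \<alpha>)) \<in> inv_image {(\<alpha>, \<beta>). \<alpha> < \<beta>} snd"
    by (simp add: is_succ_of_the) (simp add: is_succ_of_def)
qed simp

declare iter.simps [simp del]

lemma iter_zero: "is_zero \<alpha> \<Longrightarrow> iter d \<alpha> = id"
  by (simp add: iter.simps)

lemma iter_succ:
  assumes "is_succ_of \<alpha> \<beta>"
  shows "iter d \<alpha> = d \<circ> iter d \<beta>"
proof -
  have "\<not> is_zero \<alpha>" using assms by (auto simp: is_succ_of_def is_zero_def not_le)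
  then show ?thesis
    using assms by (subst iter.simps) (auto simp: is_succ_of_the)
qed

lemma iter_limit: "is_limit \<alpha> \<Longrightarrow> iter d \<alpha> = (\<lambda>x. SUP \<beta>\<in>{..<\<alpha>}. iter d \<beta> x)"
  by (subst iter.simps) (auto simp: is_limit_def)

lemma ordinal_cases:
  obtains "is_zero \<alpha>" | \<beta> where "is_succ_of \<alpha> \<beta>" | "is_limit \<alpha>"
  unfolding is_limit_def by blast

lemma ex_succ:
  fixes \<alpha> \<beta> :: "'o::wellorder"
  assumes "\<alpha> < \<beta>"
  obtains \<gamma> where "is_succ_of \<gamma> \<alpha>" "\<gamma> \<le> \<beta>"
proof
  show "is_succ_of (LEAST \<gamma>. \<alpha> < \<gamma>) \<alpha>"
    unfolding is_succ_of_def by (metis LeastI assms not_less_Least not_le)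
  show "(LEAST \<gamma>. \<alpha> < \<gamma>) \<le> \<beta>"
    using assms by (rule Least_le)
qed

lemma iter_increasing:
  assumes "inflator d" "\<beta> \<le> \<alpha>"
  shows "iter d \<beta> x \<le> iter d \<alpha> x"
  using assms(2)
proof (induction \<alpha> rule: less_induct)
  case (less \<alpha>)
  show ?case
  proof (cases "\<beta> = \<alpha>")
    case False
    with less.prems have "\<beta> < \<alpha>" by simp
    show ?thesis
    proof (cases \<alpha> rule: ordinal_cases)
      case 1
      then show ?thesis using \<open>\<beta> < \<alpha>\<close> by (auto simp: is_zero_def not_le dest: leD)
    next
      case (2 \<gamma>)
      then have "\<gamma> < \<alpha>" "\<beta> \<le> \<gamma>" using \<open>\<beta> < \<alpha>\<close> by (auto simp: is_succ_of_def)
      from less.IH[OF this] have "iter d \<beta> x \<le> d (iter d \<gamma> x)"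
        using assms(1) unfolding inflator_def by (meson order_trans)
      then show ?thesis by (simp add: iter_succ[OF 2])
    next
      case 3
      then show ?thesis using \<open>\<beta> < \<alpha>\<close> by (auto simp: iter_limit intro: SUP_upper)
    qed
  qed simp
qed

lemma iter_stationary:
  assumes d: "inflator d" and "d \<circ> iter d \<alpha> = iter d \<alpha>" "\<alpha> \<le> \<beta>"
  shows "iter d \<beta> = iter d \<alpha>"
  using assms(3)
proof (induction \<beta> rule: less_induct)
  case (less \<beta>)
  show ?case
  proof (cases "\<alpha> = \<beta>")
    case False
    with less.prems have "\<alpha> < \<beta>" by simp
    show ?thesis
    proof (cases \<beta> rule: ordinal_cases)
      case 1
      then show ?thesis using \<open>\<alpha> < \<beta>\<close> by (auto simp: is_zero_def dest: leD)
    next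
      case (2 \<gamma>)
      then have "\<gamma> < \<beta>" "\<alpha> \<le> \<gamma>" using \<open>\<alpha> < \<beta>\<close> by (auto simp: is_succ_of_def)
      from less.IH[OF this] show ?thesis by (simp add: iter_succ[OF 2] assms(2))
    next
      case 3
      show ?thesis
      proof (rule ext, rule antisym)
        fix x
        have "iter d \<gamma> x \<le> iter d \<alpha> x" if "\<gamma> < \<beta>" for \<gamma>
          using less.IH[OF that] iter_increasing[OF d, of \<gamma> \<alpha> x] by (metis linear order_refl)
        then show "iter d \<beta> x \<le> iter d \<alpha> x"
          by (auto simp: iter_limit[OF 3] intro: SUP_least)
        show "iter d \<alpha> x \<le> iter d \<beta> x"
          using d less.prems by (rule iter_increasing)
      qed
    qed
  qed simp
qed

lemma iter_stabilizes:
  fixes d :: "'a::complete_lattice \<Rightarrow> 'a"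
  assumes d: "inflator d"
  obtains \<alpha> :: "('a \<Rightarrow> 'a) ordinal" where "d \<circ> iter d \<alpha> = iter d \<alpha>"
proof -
  let ?g = "\<lambda>X. iter d (Abs_ordinal X :: ('a \<Rightarrow> 'a) ordinal)"
  have "\<not> inj ?g"
  proof
    assume "inj ?g"
    then have "range (inv ?g) = Pow UNIV" by (simp add: inj_imp_surj_inv)
    then show False using Cantors_theorem by blast
  qed
  then obtain X Y where "X \<noteq> Y" "?g X = ?g Y" by (auto simp: inj_def)
  then have "Abs_ordinal X \<noteq> Abs_ordinal Y" by (simp add: Abs_ordinal_inject)
  then obtain \<alpha> \<beta> :: "('a \<Rightarrow> 'a) ordinal" where "\<alpha> < \<beta>" and eq: "iter d \<alpha> = iter d \<beta>"
    using \<open>?g X = ?g Y\<close> by (metis neqE)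
  then obtain \<gamma> where \<gamma>: "is_succ_of \<gamma> \<alpha>" "\<gamma> \<le> \<beta>" using ex_succ by blast
  have "d (iter d \<alpha> x) = iter d \<alpha> x" for x
  proof (rule antisym)
    have "iter d \<gamma> x \<le> iter d \<beta> x" using d \<gamma>(2) by (rule iter_increasing)
    then show "d (iter d \<alpha> x) \<le> iter d \<alpha> x" by (simp add: iter_succ[OF \<gamma>(1)] eq)
    show "iter d \<alpha> x \<le> d (iter d \<alpha> x)" using d by (simp add: inflator_def)
  qed
  then have "d \<circ> iter d \<alpha> = iter d \<alpha>" by (simp add: fun_eq_iff)
  then show ?thesis by (rule that)
qed

lemma iter_stable_inflator:
  fixes d :: "'a::meet_continuous_lattice \<Rightarrow> 'a"
  assumes d: "inflator d \<and> stable_map d"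
  shows "inflator (iter d (\<alpha> :: 'o::wellorder)) \<and> stable_map (iter d \<alpha>)"
proof (induction \<alpha> rule: less_induct)
  case (less \<alpha>)
  show ?case
  proof (cases \<alpha> rule: ordinal_cases)
    case 1
    then show ?thesis by (auto simp: iter_zero inflator_def stable_map_def mono_def)
  next
    case (2 \<beta>)
    have "inflator (iter d \<beta>) \<and> stable_map (iter d \<beta>)"
      using 2 by (intro less.IH) (simp add: is_succ_of_def)
    from stable_inflator_comp[OF d this] show ?thesis by (simp add: iter_succ[OF 2] o_def)
  next
    case 3
    have "\<exists>\<beta>. \<beta> < \<alpha>" using 3 by (auto simp: is_limit_def is_zero_def not_le)
    moreover have "\<exists>\<delta><\<alpha>. iter d \<beta> \<le> iter d \<delta> \<and> iter d \<gamma> \<le> iter d \<delta>" if "\<beta> < \<alpha>" "\<gamma> < \<alpha>" for \<beta> \<gamma> :: 'o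
    proof (intro exI conjI)
      show "max \<beta> \<gamma> < \<alpha>" using that by simp
      show "iter d \<beta> \<le> iter d (max \<beta> \<gamma>)" "iter d \<gamma> \<le> iter d (max \<beta> \<gamma>)"
        using d by (auto intro!: le_funI iter_increasing)
    qed
    ultimately have "directed (iter d ` {..<\<alpha>})"
      by (fastforce simp: directed_def)
    then have "inflator (\<lambda>x. SUP f\<in>iter d ` {..<\<alpha>}. f x) \<and> stable_map (\<lambda>x. SUP f\<in>iter d ` {..<\<alpha>}. f x)"
      using less.IH by (intro SUP_directed_stable_inflator) auto
    then show ?thesis by (simp add: iter_limit[OF 3] image_image)
  qed
qed

definition iter_inf :: "('a::complete_lattice \<Rightarrow> 'a) \<Rightarrow> 'a \<Rightarrow> 'a" where
  "iter_inf d = (THE f. \<exists>\<alpha> :: ('a \<Rightarrow> 'a) ordinal. \<forall>\<beta>\<ge>\<alpha>. iter d \<beta> = f)"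

lemma iter_inf_eq:
  fixes d :: "'a::complete_lattice \<Rightarrow> 'a" and \<alpha> :: "('a \<Rightarrow> 'a) ordinal"
  assumes "inflator d" "d \<circ> iter d \<alpha> = iter d \<alpha>"
  shows "iter_inf d = iter d \<alpha>"
proof -
  have stat: "iter d \<beta> = iter d \<alpha>" if "\<beta> \<ge> \<alpha>" for \<beta>
    using assms that by (rule iter_stationary)
  have uniq: "f = iter d \<alpha>" if "\<forall>\<beta>\<ge>\<alpha>'. iter d \<beta> = f" for f and \<alpha>' :: "('a \<Rightarrow> 'a) ordinal"
    using stat[of "max \<alpha> \<alpha>'"] that by simp
  show ?thesis
    unfolding iter_inf_def
  proof (rule the_equality)
    show "\<exists>\<alpha>' :: ('a \<Rightarrow> 'a) ordinal. \<forall>\<beta>\<ge>\<alpha>'. iter d \<beta> = iter d \<alpha>"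
      by (intro exI[of _ \<alpha>] allI impI) (rule stat)
  qed (erule exE, rule uniq)
qed

lemma iter_inf_fixed:
  fixes d :: "'a::complete_lattice \<Rightarrow> 'a"
  assumes "inflator d"
  shows "d \<circ> iter_inf d = iter_inf d"
proof -
  obtain \<alpha> :: "('a \<Rightarrow> 'a) ordinal" where \<alpha>: "d \<circ> iter d \<alpha> = iter d \<alpha>"
    using assms by (rule iter_stabilizes)
  then show ?thesis by (simp only: iter_inf_eq[OF assms \<alpha>])
qed

lemma iter_inf_stable_inflator:
  fixes d :: "'a::meet_continuous_lattice \<Rightarrow> 'a"
  assumes "inflator d \<and> stable_map d"
  shows "inflator (iter_inf d) \<and> stable_map (iter_inf d)"
proof -
  obtain \<alpha> :: "('a \<Rightarrow> 'a) ordinal" where "d \<circ> iter d \<alpha> = iter d \<alpha>"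
    using conjunct1[OF assms] by (rule iter_stabilizes)
  with assms have "iter_inf d = iter d \<alpha>" by (intro iter_inf_eq) auto
  then show ?thesis using iter_stable_inflator[OF assms, of \<alpha>] by (simp only:)
qed

text \<open>On a meet-continuous lattice, such as an idiom $A$ or $S(A)$, the map $d^\infty$ is
  again a stable inflator.\<close>

lift_definition stable_inf ::
  "'a::meet_continuous_lattice stable_inflator \<Rightarrow> 'a stable_inflator"  ("_\<^sup>\<infinity>" [1000] 999)
  is iter_inf
  by (rule iter_inf_stable_inflator)


section \<open>Partial totalizer and dimension\<close>

lift_definition mu ::
  "'a::complete_lattice stable_inflator \<Rightarrow> 'a stable_inflator stable_inflator"  ("\<mu>")
  is "\<lambda>k d. d \<cdot> k"
proof (rule stable_inflatorI)
  fix k d e :: "'a stable_inflator"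
  show "d \<cdot> k \<le> e \<cdot> k" if "d \<le> e"
    using that by (simp add: le_iff_app inflator_comp.rep_eq)
  show "d \<le> d \<cdot> k"
    by (simp add: le_iff_app inflator_comp.rep_eq app_mono app_ge)
  show "inf (d \<cdot> k) e \<le> inf d e \<cdot> k"
    unfolding le_iff_app inflator_comp.rep_eq inf_stable_inflator.rep_eq
    by (intro allI inf_mono order_refl app_mono app_ge)
qed

definition partial_totalizer ::
  "'a::complete_lattice stable_inflator stable_inflator \<Rightarrow> 'a stable_inflator stable_inflator" where
  "partial_totalizer M = Inf {K. K \<cdot> M = top}"

definition has_dimension ::
  "'a::meet_continuous_lattice stable_inflator stable_inflator \<Rightarrow> 'a stable_inflator \<Rightarrow> bool" where
  "has_dimension J d \<longleftrightarrow> app (J\<^sup>\<infinity>) d = top"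

end

theory Submission
  imports Defs
begin

text \<open>
  All three conditions say that \<open>J\<^sup>\<infinity>\<close> lies in the up-closed set of those \<open>K\<close> with
  \<open>K \<cdot> M = top\<close>, for \<open>M = \<mu> (s\<^sup>\<infinity>)\<close>. Infima of stable inflators are pointwise, so this
  set is closed under infima and is the principal filter generated by the partial totalizer
  of \<open>M\<close> (\<open>partial_totalizer_le_iff\<close>). By monotonicity, \<open>K \<cdot> M\<close> is constantly \<open>top\<close> as
  soon as it is \<open>top\<close> at \<open>bot\<close> (\<open>comp_eq_top_iff\<close>), and \<open>M\<close> sends \<open>bot\<close>, the identity
  inflator, to \<open>s\<^sup>\<infinity>\<close>; so membership in the set is the same as \<open>K\<close> taking \<open>s\<^sup>\<infinity>\<close> to
  \<open>top\<close>, which for \<open>K = J\<^sup>\<infinity>\<close> is having \<open>J\<close>-dimension.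
\<close>

lemma app_mu_bot: "app (\<mu> k) bot = k"
  by (simp add: mu.rep_eq inflator_comp.rep_eq bot_stable_inflator.rep_eq flip: app_inject)

lemma comp_eq_top_iff:
  fixes K M :: "'a::complete_lattice stable_inflator"
  shows "K \<cdot> M = top \<longleftrightarrow> app K (app M bot) = top"
proof
  assume "K \<cdot> M = top"
  then show "app K (app M bot) = top"
    by (metis inflator_comp.rep_eq top_stable_inflator.rep_eq)
next
  assume "app K (app M bot) = top"
  then have "app K (app M x) = top" for x
    by (metis app_mono bot_least top_unique)
  then show "K \<cdot> M = top"
    by (simp add: inflator_comp.rep_eq top_stable_inflator.rep_eq fun_eq_iff flip: app_inject)
qed

text \<open>
  The infimum defining the partial totalizer is attained: a pointwise infimum of maps that
  take the value \<open>top\<close> at \<open>app M bot\<close> takes the value \<open>top\<close> there as well.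
\<close>

lemma partial_totalizer_le_iff: "partial_totalizer M \<le> K \<longleftrightarrow> K \<cdot> M = top"
proof
  assume "K \<cdot> M = top"
  then show "partial_totalizer M \<le> K"
    unfolding partial_totalizer_def by (intro Inf_lower) simp
next
  have "app (partial_totalizer M) (app M bot) = top"
    unfolding partial_totalizer_def Inf_stable_inflator.rep_eq
    by (simp add: comp_eq_top_iff)
  moreover assume "partial_totalizer M \<le> K"
  ultimately have "app K (app M bot) = top"
    by (metis le_iff_app top_unique)
  then show "K \<cdot> M = top" by (simp only: comp_eq_top_iff)
qed

theorem theorem4p11:
  fixes s :: "'a::idiom stable_inflator"
    and J :: "'a stable_inflator stable_inflator"
  shows "(J\<^sup>\<infinity> \<cdot> \<mu> (s\<^sup>\<infinity>) = top \<longleftrightarrow> partial_totalizer (\<mu> (s\<^sup>\<infinity>)) \<le> J\<^sup>\<infinity>)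
    \<and> (partial_totalizer (\<mu> (s\<^sup>\<infinity>)) \<le> J\<^sup>\<infinity> \<longleftrightarrow> has_dimension J (s\<^sup>\<infinity>))"
  by (simp add: partial_totalizer_le_iff comp_eq_top_iff app_mu_bot has_dimension_def)

end
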